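(* The axiom system $\Sigma^\sharp = \{A3, B1, B2, B3, B4, B6, B7, B8\}$ described in the context is completely independent: for every subset $A \subseteq \Sigma^\sharp$, the set of sentences $A \cup \{\neg\varphi : \varphi \in \Sigma^\sharp \setminus A\}$ is satisfiable.
   Context: Work in classical one-sorted first-order logic with equality, in the language with three constant symbols $a_0, a_1, a_2$, a ternary relation symbol $L$ (collinearity) and a ternary function symbol $\tau$. Write $\sigma(a,b)$ as an abbreviation for $\tau(b,a,a)$. The axioms below are understood as universally closed sentences: A3: $a \ne b \wedge L(a,b,c) \wedge L(a,b,d) \rightarrow L(a,c,d)$; B1: $L(a,b,c) \rightarrow L(b,a,c)$; B2: $\tau(a,b,c) = \tau(a,c,b)$; B3: $L(a,b,\sigma(a,b))$; B4: $L(a,b,c) \rightarrow L(x, \tau(a,b,x), \tau(a,c,x))$; B6: $\tau(a,b,x) = \tau(c, \tau(a,b,x), x)$; B7: $\neg L(a_0,a_1,a_2)$; B8: $\sigma(a,b) = b \rightarrow a = b$. $\Sigma^\sharp$ is the set $\{A3,B1,B2,B3,B4,B6,B7,B8\}$. *)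

theory Defs
  imports Main "HOL-Library.Countable_Set"
begin

section \<open>First-order logic with equality over the language of collinearity and \<open>\<tau>\<close>\<close>

datatype csym = A0 | A1 | A2

datatype trm = Var nat | Cst csym | Tau trm trm trm

datatype fm =
    Eq trm trm
  | Col trm trm trm
  | Neg fm
  | Conj fm fm
  | Impl fm fm
  | Forall nat fm

text \<open>The remaining connectives and the existential quantifier are classically definable.\<close>

primrec fvt :: "trm \<Rightarrow> nat set" where
  "fvt (Var i) = {i}"
| "fvt (Cst k) = {}"
| "fvt (Tau s t u) = fvt s \<union> fvt t \<union> fvt u"

primrec fv :: "fm \<Rightarrow> nat set" where
  "fv (Eq s t) = fvt s \<union> fvt t"
| "fv (Col s t u) = fvt s \<union> fvt t \<union> fvt u"
| "fv (Neg p) = fv p"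
| "fv (Conj p q) = fv p \<union> fv q"
| "fv (Impl p q) = fv p \<union> fv q"
| "fv (Forall i p) = fv p - {i}"

definition sentence :: "fm \<Rightarrow> bool" where
  "sentence p \<longleftrightarrow> fv p = {}"

definition uclosure :: "fm \<Rightarrow> fm" where
  "uclosure p = foldr Forall (sorted_list_of_set (fv p)) p"

record 'u struct =
  univ :: "'u set"
  cst :: "csym \<Rightarrow> 'u"
  col :: "'u \<Rightarrow> 'u \<Rightarrow> 'u \<Rightarrow> bool"
  tau :: "'u \<Rightarrow> 'u \<Rightarrow> 'u \<Rightarrow> 'u"

text \<open>Nonemptiness of the domain follows from the first conjunct.\<close>

definition is_struct :: "'u struct \<Rightarrow> bool" where
  "is_struct M \<longleftrightarrow>
     (\<forall>k. cst M k \<in> univ M) \<and>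
     (\<forall>a\<in>univ M. \<forall>b\<in>univ M. \<forall>c\<in>univ M. tau M a b c \<in> univ M)"

primrec val :: "'u struct \<Rightarrow> (nat \<Rightarrow> 'u) \<Rightarrow> trm \<Rightarrow> 'u" where
  "val M e (Var i) = e i"
| "val M e (Cst k) = cst M k"
| "val M e (Tau s t u) = tau M (val M e s) (val M e t) (val M e u)"

primrec sat :: "'u struct \<Rightarrow> (nat \<Rightarrow> 'u) \<Rightarrow> fm \<Rightarrow> bool" where
  "sat M e (Eq s t) \<longleftrightarrow> val M e s = val M e t"
| "sat M e (Col s t u) \<longleftrightarrow> col M (val M e s) (val M e t) (val M e u)"
| "sat M e (Neg p) \<longleftrightarrow> \<not> sat M e p"
| "sat M e (Conj p q) \<longleftrightarrow> sat M e p \<and> sat M e q"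
| "sat M e (Impl p q) \<longleftrightarrow> (sat M e p \<longrightarrow> sat M e q)"
| "sat M e (Forall i p) \<longleftrightarrow> (\<forall>d\<in>univ M. sat M (e(i := d)) p)"

definition model_of :: "'u struct \<Rightarrow> fm set \<Rightarrow> bool" where
  "model_of M \<Gamma> \<longleftrightarrow> is_struct M \<and>
     (\<forall>p\<in>\<Gamma>. \<forall>e. range e \<subseteq> univ M \<longrightarrow> sat M e p)"

text \<open>HOL cannot quantify existentially over types, so the domain is taken to be a set of
  natural numbers.  As the language is countable this is no restriction: by the downward
  Loewenheim-Skolem theorem, proved below as \<open>satisfiable_if_model\<close>, a set of formulas that
  has a model over any type is satisfiable in this sense.\<close>

definition satisfiable :: "fm set \<Rightarrow> bool" where
  "satisfiable \<Gamma> \<longleftrightarrow> (\<exists>M :: nat struct. model_of M \<Gamma>)"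


section \<open>The axioms\<close>

abbreviation (input) "va \<equiv> Var 0"
abbreviation (input) "vb \<equiv> Var 1"
abbreviation (input) "vc \<equiv> Var 2"
abbreviation (input) "vd \<equiv> Var 3"
abbreviation (input) "vx \<equiv> Var 4"

definition Sig :: "trm \<Rightarrow> trm \<Rightarrow> trm" where
  "Sig s t = Tau t s s"

definition ax_A3 :: fm where
  "ax_A3 = uclosure
     (Impl (Conj (Neg (Eq va vb)) (Conj (Col va vb vc) (Col va vb vd))) (Col va vc vd))"

definition ax_B1 :: fm where
  "ax_B1 = uclosure (Impl (Col va vb vc) (Col vb va vc))"

definition ax_B2 :: fm where
  "ax_B2 = uclosure (Eq (Tau va vb vc) (Tau va vc vb))"

definition ax_B3 :: fm where
  "ax_B3 = uclosure (Col va vb (Sig va vb))"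

definition ax_B4 :: fm where
  "ax_B4 = uclosure (Impl (Col va vb vc) (Col vx (Tau va vb vx) (Tau va vc vx)))"

definition ax_B6 :: fm where
  "ax_B6 = uclosure (Eq (Tau va vb vx) (Tau vc (Tau va vb vx) vx))"

definition ax_B7 :: fm where
  "ax_B7 = uclosure (Neg (Col (Cst A0) (Cst A1) (Cst A2)))"

definition ax_B8 :: fm where
  "ax_B8 = uclosure (Impl (Eq (Sig va vb) vb) (Eq va vb))"

definition Sigma_sharp :: "fm set" where
  "Sigma_sharp = {ax_A3, ax_B1, ax_B2, ax_B3, ax_B4, ax_B6, ax_B7, ax_B8}"


section \<open>Basic facts\<close>

lemma finite_fvt [simp]: "finite (fvt t)"
  by (induction t) auto

lemma finite_fv [simp]: "finite (fv p)"
  by (induction p) auto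

lemma fv_foldr_Forall: "fv (foldr Forall xs p) = fv p - set xs"
  by (induction xs) auto

lemma sentence_uclosure: "sentence (uclosure p)"
  by (simp add: sentence_def uclosure_def fv_foldr_Forall)

lemma sentence_Sigma_sharp: "p \<in> Sigma_sharp \<Longrightarrow> sentence p"
  unfolding Sigma_sharp_def ax_A3_def ax_B1_def ax_B2_def ax_B3_def ax_B4_def ax_B6_def
    ax_B7_def ax_B8_def
  using sentence_uclosure by auto

lemma val_cong: "(\<And>i. i \<in> fvt t \<Longrightarrow> e i = e' i) \<Longrightarrow> val M e t = val M e' t"
  by (induction t) (simp_all)

lemma sat_cong: "(\<And>i. i \<in> fv p \<Longrightarrow> e i = e' i) \<Longrightarrow> sat M e p \<longleftrightarrow> sat M e' p"
proof (induction p arbitrary: e e')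
  case (Eq s t)
  then show ?case using val_cong[of s e e' M] val_cong[of t e e' M] by simp
next
  case (Col s t u)
  then show ?case
    using val_cong[of s e e' M] val_cong[of t e e' M] val_cong[of u e e' M] by simp
next
  case (Neg p)
  from Neg.IH[of e e'] Neg.prems show ?case by simp
next
  case (Conj p q)
  from Conj.IH(1)[of e e'] Conj.IH(2)[of e e'] Conj.prems show ?case by simp
next
  case (Impl p q)
  from Impl.IH(1)[of e e'] Impl.IH(2)[of e e'] Impl.prems show ?case by simp
next
  case (Forall i p)
  have "sat M (e(i := d)) p \<longleftrightarrow> sat M (e'(i := d)) p" for d
    by (rule Forall.IH) (use Forall.prems in auto)
  then show ?case by simp
qed

lemma sat_foldr_Forall_all:
  assumes "range e \<subseteq> univ M"
  shows "sat M e (foldr Forall xs p) \<longleftrightarrow>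
    (\<forall>e'. range e' \<subseteq> univ M \<and> (\<forall>i. i \<notin> set xs \<longrightarrow> e' i = e i) \<longrightarrow> sat M e' p)"
  using assms
proof (induction xs arbitrary: e)
  case Nil
  have "e' = e" if "\<forall>i. e' i = e i" for e' using that by auto
  with Nil show ?case by auto
next
  case (Cons x xs)
  have IH: "sat M (e(x := d)) (foldr Forall xs p) \<longleftrightarrow>
      (\<forall>e'. range e' \<subseteq> univ M \<and> (\<forall>i. i \<notin> set xs \<longrightarrow> e' i = (e(x := d)) i) \<longrightarrow> sat M e' p)"
    if "d \<in> univ M" for d
    by (rule Cons.IH) (use Cons.prems that in auto)
  show ?case (is "?l \<longleftrightarrow> ?r")
  proof
    assume l: ?l
    show ?r
    proof (intro allI impI)
      fix e' assume e': "range e' \<subseteq> univ M \<and> (\<forall>i. i \<notin> set (x # xs) \<longrightarrow> e' i = e i)"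
      then have d: "e' x \<in> univ M" by auto
      have "sat M (e(x := e' x)) (foldr Forall xs p)" using l d by simp
      then show "sat M e' p" using e' unfolding IH[OF d] by auto
    qed
  next
    assume r: ?r
    have "sat M (e(x := d)) (foldr Forall xs p)" if "d \<in> univ M" for d
      unfolding IH[OF that] using r by auto
    then show ?l by simp
  qed
qed

lemma sat_uclosure:
  assumes e: "range e \<subseteq> univ M"
  shows "sat M e (uclosure p) \<longleftrightarrow> (\<forall>e'. range e' \<subseteq> univ M \<longrightarrow> sat M e' p)"
proof
  assume l: "sat M e (uclosure p)"
  show "\<forall>e'. range e' \<subseteq> univ M \<longrightarrow> sat M e' p"
  proof (intro allI impI)
    fix e' :: "nat \<Rightarrow> 'a" assume e': "range e' \<subseteq> univ M"
    define e'' where "e'' i = (if i \<in> fv p then e' i else e i)" for i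
    have "range e'' \<subseteq> univ M" using e e' by (auto simp: e''_def)
    then have "sat M e'' p"
      using l unfolding uclosure_def sat_foldr_Forall_all[OF e] by (auto simp: e''_def)
    then show "sat M e' p" using sat_cong[of p e' e'' M] by (simp add: e''_def)
  qed
next
  assume "\<forall>e'. range e' \<subseteq> univ M \<longrightarrow> sat M e' p"
  then show "sat M e (uclosure p)" unfolding uclosure_def sat_foldr_Forall_all[OF e] by auto
qed


section \<open>Downward Loewenheim-Skolem\<close>

instance csym :: countable by countable_datatype
instance trm :: countable by countable_datatype
instance fm :: countable by countable_datatype

text \<open>Names for the elements of the Skolem hull: \<open>SW p i ts\<close> names a counterexample to
  \<open>Forall i p\<close>, where the variables below \<open>length ts\<close> are valued by \<open>ts\<close>.\<close>

datatype sk = SC csym | ST sk sk sk | SW fm nat "sk list"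

instance sk :: countable by countable_datatype

definition lenv :: "'u struct \<Rightarrow> 'u list \<Rightarrow> nat \<Rightarrow> 'u" where
  "lenv M xs i = (if i < length xs then xs ! i else cst M A0)"

definition wit :: "'u struct \<Rightarrow> fm \<Rightarrow> nat \<Rightarrow> 'u list \<Rightarrow> 'u" where
  "wit M p i xs = (SOME d. d \<in> univ M \<and>
     ((\<exists>d'\<in>univ M. \<not> sat M ((lenv M xs)(i := d')) p) \<longrightarrow> \<not> sat M ((lenv M xs)(i := d)) p))"

primrec skv :: "'u struct \<Rightarrow> sk \<Rightarrow> 'u" where
  "skv M (SC k) = cst M k"
| "skv M (ST s t u) = tau M (skv M s) (skv M t) (skv M u)"
| "skv M (SW p i ts) = wit M p i (map (skv M) ts)"

lemma wit:
  assumes "is_struct M"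
  shows "wit M p i xs \<in> univ M"
    and "\<exists>d'\<in>univ M. \<not> sat M ((lenv M xs)(i := d')) p \<Longrightarrow>
      \<not> sat M ((lenv M xs)(i := wit M p i xs)) p"
proof -
  have "\<exists>d. d \<in> univ M \<and> ((\<exists>d'\<in>univ M. \<not> sat M ((lenv M xs)(i := d')) p) \<longrightarrow>
      \<not> sat M ((lenv M xs)(i := d)) p)"
    using assms unfolding is_struct_def by blast
  from someI_ex[OF this, folded wit_def]
  show "wit M p i xs \<in> univ M"
    and "\<exists>d'\<in>univ M. \<not> sat M ((lenv M xs)(i := d')) p \<Longrightarrow>
      \<not> sat M ((lenv M xs)(i := wit M p i xs)) p" by blast+
qed

lemma skv_dom: "is_struct M \<Longrightarrow> skv M t \<in> univ M"
  by (induction t) (auto simp: is_struct_def wit(1))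

theorem satisfiable_if_model:
  fixes M :: "'u struct"
  assumes "model_of M \<Gamma>"
  shows "satisfiable \<Gamma>"
proof -
  have M: "is_struct M" using assms by (simp add: model_of_def)
  define H where "H = range (skv M)"
  have cH: "countable H" by (simp add: H_def)
  have HM: "H \<subseteq> univ M" using skv_dom[OF M] by (auto simp: H_def)
  define f where "f = to_nat_on H"
  define g where "g = inv_into H f"
  have inj: "inj_on f H" unfolding f_def by (rule inj_on_to_nat_on[OF cH])
  have gf: "g (f h) = h" if "h \<in> H" for h using inj that by (simp add: g_def)
  have fg: "f (g n) = n" "g n \<in> H" if "n \<in> f ` H" for n
    using that by (auto simp: g_def inv_into_into f_inv_into_f)
  have cH': "cst M k \<in> H" for k unfolding H_def by (metis rangeI skv.simps(1))
  have tH: "tau M a b c \<in> H" if abc: "a \<in> H" "b \<in> H" "c \<in> H" for a b c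
  proof -
    obtain r s t where "a = skv M r" "b = skv M s" "c = skv M t"
      using abc unfolding H_def by blast
    then have "tau M a b c = skv M (ST r s t)" by simp
    then show ?thesis unfolding H_def by (simp only: rangeI)
  qed
  have wH: "wit M p i xs \<in> H" if sub: "set xs \<subseteq> H" for p i xs
  proof -
    obtain ts where "xs = map (skv M) ts" using sub unfolding H_def
      by (metis ex_map_conv image_iff subsetD)
    then have "wit M p i xs = skv M (SW p i ts)" by simp
    then show ?thesis unfolding H_def by (simp only: rangeI)
  qed
  define N where "N = \<lparr>univ = f ` H, cst = (\<lambda>k. f (cst M k)),
      col = (\<lambda>a b c. col M (g a) (g b) (g c)), tau = (\<lambda>a b c. f (tau M (g a) (g b) (g c)))\<rparr>"
  have N: "is_struct N" unfolding is_struct_def N_def using cH' tH fg by simp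
  have v: "g (val N e t) = val M (\<lambda>j. g (e j)) t \<and> val N e t \<in> f ` H" if "range e \<subseteq> f ` H" for e t
    using that
  proof (induction t)
    case (Var i)
    then show ?case by auto
  next
    case (Cst k)
    then show ?case by (simp add: N_def gf cH')
  next
    case (Tau s t u)
    note st = Tau.IH[OF Tau.prems]
    have "g (val N e s) \<in> H" "g (val N e t) \<in> H" "g (val N e u) \<in> H"
      using st fg(2) by blast+
    then have h: "tau M (g (val N e s)) (g (val N e t)) (g (val N e u)) \<in> H" by (rule tH)
    have "val N e (Tau s t u) = f (tau M (g (val N e s)) (g (val N e t)) (g (val N e u)))"
      by (simp add: N_def)
    then show ?case using st gf[OF h] h by simp
  qed
  have s: "sat N e p \<longleftrightarrow> sat M (\<lambda>j. g (e j)) p" if "range e \<subseteq> f ` H" for e p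
    using that
  proof (induction p arbitrary: e)
    case (Eq s t)
    have "val N e s = val N e t \<longleftrightarrow> g (val N e s) = g (val N e t)"
      using v[OF Eq] fg(1) by metis
    then show ?case using v[OF Eq] by simp
  next
    case (Col s t u)
    then show ?case using v[OF Col] by (simp add: N_def)
  next
    case (Forall i p)
    let ?e = "\<lambda>j. g (e j)"
    have eH: "range ?e \<subseteq> H" using Forall.prems fg(2) by auto
    have upd: "(\<lambda>j. g ((e(i := d)) j)) = ?e(i := g d)" for d by auto
    have IH: "sat N (e(i := f h)) p \<longleftrightarrow> sat M (?e(i := h)) p" if h: "h \<in> H" for h
    proof -
      have "range (e(i := f h)) \<subseteq> f ` H" using Forall.prems h by auto
      then have "sat N (e(i := f h)) p \<longleftrightarrow> sat M (\<lambda>j. g ((e(i := f h)) j)) p"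
        by (rule Forall.IH)
      then show ?thesis by (simp only: upd gf[OF h])
    qed
    have "sat M (?e(i := d)) p" if a: "\<forall>h\<in>H. sat M (?e(i := h)) p" and d: "d \<in> univ M" for d
    proof (rule ccontr)
      assume n: "\<not> sat M (?e(i := d)) p"
      obtain m where m: "\<And>j. j \<in> fv p \<Longrightarrow> j < m"
        using finite_fv[of p] by (meson finite_nat_set_iff_bounded)
      define xs where "xs = map ?e [0..<m]"
      have xs: "set xs \<subseteq> H" using eH by (auto simp: xs_def)
      have eq: "sat M ((lenv M xs)(i := h)) p \<longleftrightarrow> sat M (?e(i := h)) p" for h
        by (rule sat_cong) (simp add: lenv_def xs_def m)
      have "\<not> sat M ((lenv M xs)(i := wit M p i xs)) p"
        by (rule wit(2)[OF M]) (use n d eq in blast)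
      then show False using a wH[OF xs] eq by blast
    qed
    then have "(\<forall>d\<in>univ M. sat M (?e(i := d)) p) \<longleftrightarrow> (\<forall>h\<in>H. sat M (?e(i := h)) p)"
      using HM by blast
    moreover have "sat N e (Forall i p) \<longleftrightarrow> (\<forall>h\<in>H. sat N (e(i := f h)) p)"
      by (simp add: N_def)
    ultimately show ?case using IH by simp
  qed auto
  have "model_of N \<Gamma>"
    unfolding model_of_def
  proof (intro conjI N ballI allI impI)
    fix p and e :: "nat \<Rightarrow> nat"
    assume p: "p \<in> \<Gamma>" and "range e \<subseteq> univ N"
    then have e: "range e \<subseteq> f ` H" by (simp add: N_def)
    then have "range (\<lambda>j. g (e j)) \<subseteq> univ M" using fg(2) HM by fastforce
    then show "sat N e p" using assms p s[OF e] by (simp add: model_of_def)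
  qed
  then show ?thesis unfolding satisfiable_def by blast
qed

end

theory Submission
  imports Defs
begin

text \<open>For a set \<open>S\<close> of axioms take the direct product of factors on the natural numbers, where the
  factor of an axiom \<open>i \<in> S\<close> other than B7 violates exactly \<open>i\<close>, and all remaining factors satisfy
  everything but possibly B7. The Horn axioms pass to products; the non-Horn A3 does so because
  every factor but the one for A3 satisfies it even without the hypothesis \<open>a \<noteq> b\<close>. Conversely, a
  violation in one factor lifts to the product, since in all factors \<open>L(1,1,1)\<close> and
  \<open>\<tau>(1,1,1) = 1\<close>, so that the constant coordinate 1 satisfies every premise. The factor at
  coordinate B7, present for every \<open>S\<close>, has a nonempty, non-total \<open>L\<close>, so B7 is controlled by the
  choice of the constants alone.\<close>

datatype ax = A3 | B1 | B2 | B3 | B4 | B6 | B7 | B8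

primrec axm :: "ax \<Rightarrow> fm" where
  "axm A3 = ax_A3"
| "axm B1 = ax_B1"
| "axm B2 = ax_B2"
| "axm B3 = ax_B3"
| "axm B4 = ax_B4"
| "axm B6 = ax_B6"
| "axm B7 = ax_B7"
| "axm B8 = ax_B8"

lemma Sigma_sharp_eq_range: "Sigma_sharp = range axm"
proof -
  have UNIV_ax: "UNIV = {A3, B1, B2, B3, B4, B6, B7, B8}"
    using ax.exhaust by auto
  show ?thesis
    by (simp only: UNIV_ax Sigma_sharp_def image_insert image_empty axm.simps)
qed

section \<open>The factors and the axioms they satisfy\<close>

primrec factor_col :: "ax \<Rightarrow> nat \<Rightarrow> nat \<Rightarrow> nat \<Rightarrow> bool" where
  "factor_col A3 a b c \<longleftrightarrow> a \<le> c \<or> b \<le> c"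
| "factor_col B1 a b c \<longleftrightarrow> a \<le> c"
| "factor_col B2 a b c \<longleftrightarrow> True"
| "factor_col B3 a b c \<longleftrightarrow> c \<noteq> 0"
| "factor_col B4 a b c \<longleftrightarrow>
     c \<noteq> 0 \<and> (a = 0 \<longrightarrow> (b \<le> 2 \<longleftrightarrow> c \<le> 2)) \<and> (b = 0 \<longrightarrow> (a \<le> 2 \<longleftrightarrow> c \<le> 2))"
| "factor_col B6 a b c \<longleftrightarrow> True"
| "factor_col B7 a b c \<longleftrightarrow> c \<noteq> 0"
| "factor_col B8 a b c \<longleftrightarrow> True"

text \<open>Factor \<open>B4\<close> has two classes, the numbers up to 2 and those from 3 on; its
  relation looks at them only where \<open>a\<close> or \<open>b\<close> is 0. In \<open>B4\<close>
  and \<open>B7\<close>, sigma(0,a) is nonzero for the sake of B3 and differs from \<open>a\<close>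
  for that of B8; in \<open>B4\<close> it also stays in the class of \<open>a\<close>.\<close>

primrec factor_tau :: "ax \<Rightarrow> nat \<Rightarrow> nat \<Rightarrow> nat \<Rightarrow> nat" where
  "factor_tau A3 a b c = max b c"
| "factor_tau B1 a b c = max b c"
| "factor_tau B2 a b c = b"
| "factor_tau B3 a b c = max b c"
| "factor_tau B4 a b c =
     (if b = 0 \<and> c = 0 then if a \<le> 2 then if a = 1 then 2 else 1 else if a = 3 then 4 else 3
      else max b c)"
| "factor_tau B6 a b c = (if b = c then b else a)"
| "factor_tau B7 a b c = (if b = 0 \<and> c = 0 then if a = 1 then 2 else 1 else max b c)"
| "factor_tau B8 a b c = 1"

lemma factor_one: "factor_col i 1 1 1" "factor_tau i 1 1 1 = 1"
  by (cases i; simp)+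

text \<open>Distinct points of the product may agree in a coordinate, hence the form without
  \<open>a \<noteq> b\<close>.\<close>

lemma factor_A3:
  "i \<noteq> A3 \<Longrightarrow> factor_col i a b c \<Longrightarrow> factor_col i a b d \<Longrightarrow> factor_col i a c d"
  by (cases i) auto

lemma factor_B1: "i \<noteq> B1 \<Longrightarrow> factor_col i a b c \<Longrightarrow> factor_col i b a c"
  by (cases i) auto

lemma factor_B2: "i \<noteq> B2 \<Longrightarrow> factor_tau i a b c = factor_tau i a c b"
  by (cases i) auto

lemma factor_B3: "i \<noteq> B3 \<Longrightarrow> factor_col i a b (factor_tau i b a a)"
  by (cases i) auto

text \<open>In \<open>A3\<close> and \<open>B1\<close>, \<open>max c x\<close> is at least
  \<open>x\<close>; in \<open>B3\<close> and \<open>B7\<close>, the last value is nonzero because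
  \<open>c\<close> is; the other factors concerned have total \<open>L\<close>.\<close>

lemma factor_B4:
  "i \<noteq> B4 \<Longrightarrow> factor_col i a b c \<Longrightarrow> factor_col i x (factor_tau i a b x) (factor_tau i a c x)"
  by (cases i) auto

text \<open>The exceptional values in \<open>B4\<close> and \<open>B7\<close> are nonzero, so a
  second application with \<open>x = 0\<close> falls under \<open>max\<close> and returns
  them.\<close>

lemma factor_B6: "i \<noteq> B6 \<Longrightarrow> factor_tau i a b x = factor_tau i c (factor_tau i a b x) x"
  by (cases i) auto

text \<open>sigma(a,b) is \<open>a\<close>, except that sigma(0,b) in \<open>B4\<close> and
  \<open>B7\<close> is chosen to avoid \<open>b\<close>.\<close>

lemma factor_B8: "i \<noteq> B8 \<Longrightarrow> factor_tau i b a a = b \<Longrightarrow> a = b"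
  by (cases i) (auto split: if_splits)

section \<open>Product of the factors\<close>

definition factor_of :: "ax set \<Rightarrow> ax \<Rightarrow> ax" where
  "factor_of S i = (if i \<in> S then i else B7)"

lemma factor_of_in [simp]: "i \<in> S \<Longrightarrow> factor_of S i = i"
  by (simp add: factor_of_def)

lemma factor_of_B7 [simp]: "factor_of S B7 = B7"
  by (simp add: factor_of_def)

lemma factor_of_neq: "j \<notin> S \<Longrightarrow> j \<noteq> B7 \<Longrightarrow> factor_of S i \<noteq> j"
  by (auto simp: factor_of_def)

text \<open>The value 0 of \<open>A2\<close> at coordinate \<open>B7\<close> makes L(1,1,0) fail
  there, which yields B7; with all constants 1 every factor accepts the triple.\<close>

definition prod_struct :: "ax set \<Rightarrow> (ax \<Rightarrow> nat) struct" where
  "prod_struct S = \<lparr>univ = UNIV,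
     cst = (\<lambda>k i. if k = A2 \<and> i = B7 \<and> B7 \<notin> S then 0 else 1),
     col = (\<lambda>a b c. \<forall>i. factor_col (factor_of S i) (a i) (b i) (c i)),
     tau = (\<lambda>a b c i. factor_tau (factor_of S i) (a i) (b i) (c i))\<rparr>"

lemma prod_struct_simps [simp]:
  "univ (prod_struct S) = UNIV"
  "cst (prod_struct S) k = (\<lambda>i. if k = A2 \<and> i = B7 \<and> B7 \<notin> S then 0 else 1)"
  "col (prod_struct S) a b c \<longleftrightarrow> (\<forall>i. factor_col (factor_of S i) (a i) (b i) (c i))"
  "tau (prod_struct S) a b c = (\<lambda>i. factor_tau (factor_of S i) (a i) (b i) (c i))"
  by (simp_all add: prod_struct_def)

definition spike :: "ax \<Rightarrow> nat \<Rightarrow> ax \<Rightarrow> nat" where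
  "spike j n i = (if i = j then n else 1)"

lemma spike_same [simp]: "spike j n j = n"
  by (simp add: spike_def)

lemma spike_eq_iff [simp]: "spike j m = spike j n \<longleftrightarrow> m = n"
  by (metis spike_same)

text \<open>With \<open>col_spike\<close>, this makes \<open>spike j\<close> an embedding of factor
  \<open>j\<close> into the product.\<close>

lemma tau_spike:
  "j \<in> S \<Longrightarrow>
   tau (prod_struct S) (spike j k) (spike j m) (spike j n) = spike j (factor_tau j k m n)"
  using factor_one(2) by (auto simp: spike_def)

lemma col_spike:
  "j \<in> S \<Longrightarrow>
   col (prod_struct S) (spike j k) (spike j m) (spike j n) \<longleftrightarrow> factor_col j k m n"
  using factor_one(1) by (auto simp: spike_def)

section \<open>Semantics of the axioms\<close>

lemma all_env5:
  "(\<forall>e :: nat \<Rightarrow> 'a. P (e 0) (e 1) (e 2) (e 3) (e 4)) \<longleftrightarrow> (\<forall>a b c d x. P a b c d x)"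
proof
  assume l: "\<forall>e :: nat \<Rightarrow> 'a. P (e 0) (e 1) (e 2) (e 3) (e 4)"
  show "\<forall>a b c d x. P a b c d x"
  proof (intro allI)
    fix a b c d x
    \<comment> \<open>Only indices 0 to 4 are read, so list lookup serves as the assignment.\<close>
    show "P a b c d x"
      using l[rule_format, of "(!) [a, b, c, d, x]"] by (simp add: numeral_eq_Suc)
  qed
qed simp

lemma sat_axm:
  assumes "univ M = UNIV"
  shows "sat M e (axm A3) \<longleftrightarrow>
      (\<forall>a b c d. a \<noteq> b \<longrightarrow> col M a b c \<longrightarrow> col M a b d \<longrightarrow> col M a c d)"
    and "sat M e (axm B1) \<longleftrightarrow> (\<forall>a b c. col M a b c \<longrightarrow> col M b a c)"
    and "sat M e (axm B2) \<longleftrightarrow> (\<forall>a b c. tau M a b c = tau M a c b)"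
    and "sat M e (axm B3) \<longleftrightarrow> (\<forall>a b. col M a b (tau M b a a))"
    and "sat M e (axm B4) \<longleftrightarrow>
      (\<forall>a b c x. col M a b c \<longrightarrow> col M x (tau M a b x) (tau M a c x))"
    and "sat M e (axm B6) \<longleftrightarrow> (\<forall>a b c x. tau M a b x = tau M c (tau M a b x) x)"
    and "sat M e (axm B7) \<longleftrightarrow> \<not> col M (cst M A0) (cst M A1) (cst M A2)"
    and "sat M e (axm B8) \<longleftrightarrow> (\<forall>a b. tau M b a a = b \<longrightarrow> a = b)"
proof -
  have sat_closure: "sat M e (uclosure p) \<longleftrightarrow> (\<forall>e'. sat M e' p)" for p
    using sat_uclosure[of e M p] assms by simp
  note defs = sat_closure ax_A3_def ax_B1_def ax_B2_def ax_B3_def ax_B4_def ax_B6_def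
    ax_B7_def ax_B8_def Sig_def
  show "sat M e (axm A3) \<longleftrightarrow>
      (\<forall>a b c d. a \<noteq> b \<longrightarrow> col M a b c \<longrightarrow> col M a b d \<longrightarrow> col M a c d)"
    using all_env5[of "\<lambda>a b c d x. a \<noteq> b \<longrightarrow> col M a b c \<longrightarrow> col M a b d \<longrightarrow> col M a c d"]
    by (simp add: defs imp_conjL)
  show "sat M e (axm B1) \<longleftrightarrow> (\<forall>a b c. col M a b c \<longrightarrow> col M b a c)"
    using all_env5[of "\<lambda>a b c d x. col M a b c \<longrightarrow> col M b a c"] by (simp add: defs)
  show "sat M e (axm B2) \<longleftrightarrow> (\<forall>a b c. tau M a b c = tau M a c b)"
    using all_env5[of "\<lambda>a b c d x. tau M a b c = tau M a c b"] by (simp add: defs)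
  show "sat M e (axm B3) \<longleftrightarrow> (\<forall>a b. col M a b (tau M b a a))"
    using all_env5[of "\<lambda>a b c d x. col M a b (tau M b a a)"] by (simp add: defs)
  show "sat M e (axm B4) \<longleftrightarrow>
      (\<forall>a b c x. col M a b c \<longrightarrow> col M x (tau M a b x) (tau M a c x))"
    using all_env5[of "\<lambda>a b c d x. col M a b c \<longrightarrow> col M x (tau M a b x) (tau M a c x)"]
    by (simp add: defs)
  show "sat M e (axm B6) \<longleftrightarrow> (\<forall>a b c x. tau M a b x = tau M c (tau M a b x) x)"
    using all_env5[of "\<lambda>a b c d x. tau M a b x = tau M c (tau M a b x) x"]
    by (simp add: defs)
  show "sat M e (axm B7) \<longleftrightarrow> \<not> col M (cst M A0) (cst M A1) (cst M A2)"
    by (simp add: defs)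
  show "sat M e (axm B8) \<longleftrightarrow> (\<forall>a b. tau M b a a = b \<longrightarrow> a = b)"
    using all_env5[of "\<lambda>a b c d x. tau M b a a = b \<longrightarrow> a = b"] by (simp add: defs)
qed

section \<open>Truth and failure of the axioms in the product\<close>

lemma prod_struct_satisfies:
  assumes "i \<notin> S"
  shows "sat (prod_struct S) e (axm i)"
proof -
  note rules = sat_axm[OF prod_struct_simps(1)]
  show ?thesis
  proof (cases i)
    case A3
    note f = factor_A3[OF factor_of_neq[OF assms[unfolded A3]]]
    show ?thesis
      unfolding A3 rules using f by (simp, blast)
  next
    case B1
    note f = factor_B1[OF factor_of_neq[OF assms[unfolded B1]]]
    show ?thesis
      unfolding B1 rules using f by simp
  next
    case B2
    note f = factor_B2[OF factor_of_neq[OF assms[unfolded B2]]]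
    show ?thesis
      unfolding B2 rules using f by (simp add: fun_eq_iff)
  next
    case B3
    note f = factor_B3[OF factor_of_neq[OF assms[unfolded B3]]]
    show ?thesis
      unfolding B3 rules using f by simp
  next
    case B4
    note f = factor_B4[OF factor_of_neq[OF assms[unfolded B4]]]
    show ?thesis
      unfolding B4 rules using f by simp
  next
    case B6
    note f = factor_B6[OF factor_of_neq[OF assms[unfolded B6]]]
    show ?thesis
      unfolding B6 rules prod_struct_simps by (intro allI ext) (rule f, simp)
  next
    case B7
    then show ?thesis
      using assms unfolding B7 rules by (auto intro: exI[of _ B7])
  next
    case B8
    note f = factor_B8[OF factor_of_neq[OF assms[unfolded B8]]]
    show ?thesis
      unfolding B8 rules prod_struct_simps fun_eq_iff using f by blast
  qed
qed

lemma prod_struct_violates: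
  assumes "i \<in> S"
  shows "\<not> sat (prod_struct S) e (axm i)"
proof
  assume s: "sat (prod_struct S) e (axm i)"
  note rules = sat_axm[OF prod_struct_simps(1)] and spikes = col_spike tau_spike
  note [simp del] = prod_struct_simps
  show False
  proof (cases i)
    case A3
    \<comment> \<open>L(1,0,c) holds for every \<open>c\<close> in factor \<open>A3\<close>, while
      L(1,1,0) fails.\<close>
    then have "col (prod_struct S) (spike A3 1) (spike A3 1) (spike A3 0)"
      using s[unfolded A3 rules, rule_format,
          of "spike A3 1" "spike A3 0" "spike A3 1" "spike A3 0"] assms
      by (simp add: spikes)
    then show False
      using assms A3 by (simp add: spikes)
  next
    case B1
    then show False
      using s[unfolded B1 rules, rule_format, of "spike B1 0" "spike B1 1" "spike B1 0"] assms
      by (simp add: spikes)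
  next
    case B2
    then show False
      using s[unfolded B2 rules, rule_format, of "spike B2 0" "spike B2 0" "spike B2 1"] assms
      by (simp add: spikes)
  next
    case B3
    then show False
      using s[unfolded B3 rules, rule_format, of "spike B3 0" "spike B3 0"] assms
      by (simp add: spikes)
  next
    case B4
    \<comment> \<open>L(1,1,3) holds as no entry is 0, but \<open>x = 0\<close> turns it into
      L(0,1,3), where 1 and 3 lie in different classes.\<close>
    then show False
      using s[unfolded B4 rules, rule_format,
          of "spike B4 1" "spike B4 1" "spike B4 3" "spike B4 0"] assms
      by (simp add: spikes)
  next
    case B6
    then show False
      using s[unfolded B6 rules, rule_format,
          of "spike B6 0" "spike B6 0" "spike B6 1" "spike B6 1"] assms
      by (simp add: spikes)
  next
    case B7
    then show False
      using s[unfolded B7 rules] assms factor_one(1) by (simp add: prod_struct_simps)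
  next
    case B8
    then show False
      \<comment> \<open>The instance is \<open>b = 1\<close>, \<open>a = 0\<close>: the constant
        value 1 equals \<open>b\<close> but not \<open>a\<close>.\<close>
      using s[unfolded B8 rules, rule_format, of "spike B8 1" "spike B8 0"] assms
      by (simp add: spikes)
  qed
qed

theorem theorem2:
  shows "\<forall>A. A \<subseteq> Sigma_sharp \<longrightarrow>
           satisfiable (A \<union> {Neg p | p. p \<in> Sigma_sharp - A})"
proof (intro allI impI)
  fix A assume A: "A \<subseteq> Sigma_sharp"
  \<comment> \<open>The factors to include are those of the axioms to be refuted.\<close>
  define M where "M = prod_struct {i. axm i \<notin> A}"
  have sat_M: "sat M e (axm i) \<longleftrightarrow> axm i \<in> A" for e i
    using prod_struct_satisfies[of i "{i. axm i \<notin> A}" e]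
      prod_struct_violates[of i "{i. axm i \<notin> A}" e]
    by (auto simp: M_def)
  have "model_of M (A \<union> {Neg p | p. p \<in> Sigma_sharp - A})"
    unfolding model_of_def
  proof (intro conjI ballI allI impI)
    show "is_struct M"
      by (simp add: is_struct_def M_def)
  next
    fix p e assume "p \<in> A \<union> {Neg p | p. p \<in> Sigma_sharp - A}"
    then consider i where "p = axm i" "axm i \<in> A" | i where "p = Neg (axm i)" "axm i \<notin> A"
      using A unfolding Sigma_sharp_eq_range by blast
    then show "sat M e p"
      by cases (simp_all add: sat_M)
  qed
  \<comment> \<open>The model lives on \<open>ax \<Rightarrow> nat\<close>; downward
    Loewenheim-Skolem moves it to \<open>nat\<close>.\<close>
  then show "satisfiable (A \<union> {Neg p | p. p \<in> Sigma_sharp - A})"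
    by (rule satisfiable_if_model)
qed

end
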